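(* Let $(X,\mathfrak{B})$ and $r\colon X\to X$ be as in the context. Let $V\colon X\to[0,\infty)$ be $\mathfrak{B}$-measurable, and let $\mu_0$ be a measure on $X$ satisfying the fixed-point property $$d\mu_0=(V\,d\mu_0)\circ r^{-1}.$$ Then there exists a unique measure $\hat\mu$ on $X_\infty(r)$ such that $$\frac{d(\hat\mu\circ\hat r)}{d\hat\mu}=V\circ\theta_0\qquad\text{and}\qquad \hat\mu\circ\theta_0^{-1}=\mu_0.$$
   Context: $X$ is a non-empty set, $\mathfrak{B}$ a $\sigma$-algebra of subsets of $X$, and $r\colon X\to X$ an onto, finite-to-one, $\mathfrak{B}$-measurable map. The inverse branches of $r$ can be labelled measurably: $\mathfrak{c}(x)=\#\,r^{-1}(x)$ is measurable, and with $A_i=\{x\mid\mathfrak{c}(x)\ge i\}$, $i\in\mathbb{N}$, there are measurable maps $\tau_i\colon A_i\to X$ with $r^{-1}(x)=\{\tau_1(x),\dots,\tau_{\mathfrak{c}(x)}(x)\}$ (without repetitions) for all $x$ and $\tau_i(A_i)\in\mathfrak{B}$ for all $i$. Measures are positive and finite. $X_\infty(r)=\{(x_0,x_1,\dots)\in\prod_{n\ge0}X\mid r(x_{n+1})=x_n\text{ for all }n\ge0\}$, with projections $\theta_n(x_0,x_1,\dots)=x_n$ and the $\sigma$-algebra $\mathfrak{B}_\infty$ generated by all $\theta_n^{-1}(\mathfrak{B})$. The measurable bijection $\hat r$ of $X_\infty(r)$ is $\hat r(x_0,x_1,\dots)=(r(x_0),x_0,x_1,\dots)$, and $(\hat\mu\circ\hat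 r)(E)=\hat\mu(\hat r(E))$. The measure $(V\,d\mu_0)\circ r^{-1}$ is the push-forward under $r$ of the measure $V\,d\mu_0$, so the fixed-point property says $\int_XV\,(f\circ r)\,d\mu_0=\int_Xf\,d\mu_0$ for bounded measurable $f$. *)

theory Defs
  imports "HOL-Probability.Probability"
begin

definition fibre :: "'a measure \<Rightarrow> ('a \<Rightarrow> 'a) \<Rightarrow> 'a \<Rightarrow> 'a set" where
  "fibre B r x = {y \<in> space B. r y = x}"

definition fibre_card :: "'a measure \<Rightarrow> ('a \<Rightarrow> 'a) \<Rightarrow> 'a \<Rightarrow> nat" where
  "fibre_card B r x = card (fibre B r x)"

definition fibre_ge :: "'a measure \<Rightarrow> ('a \<Rightarrow> 'a) \<Rightarrow> nat \<Rightarrow> 'a set" where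
  "fibre_ge B r i = {x \<in> space B. fibre_card B r x \<ge> i}"

text \<open>Branches are numbered from 1. The value of \<open>\<tau> i\<close> outside \<open>fibre_ge B r i\<close> is
  unconstrained. In the last clause, bijectivity says that the listed preimages have no
  repetitions.\<close>

definition measurable_branches :: "'a measure \<Rightarrow> ('a \<Rightarrow> 'a) \<Rightarrow> bool" where
  "measurable_branches B r \<longleftrightarrow>
     fibre_card B r \<in> measurable B (count_space UNIV) \<and>
     (\<exists>\<tau> :: nat \<Rightarrow> 'a \<Rightarrow> 'a.
        (\<forall>i\<ge>1. \<tau> i \<in> measurable (restrict_space B (fibre_ge B r i)) B \<and>
               \<tau> i ` fibre_ge B r i \<in> sets B) \<and>
        (\<forall>x\<in>space B. bij_betw (\<lambda>i. \<tau> i x) {1..fibre_card B r x} (fibre B r x)))"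

definition solenoid :: "'a measure \<Rightarrow> ('a \<Rightarrow> 'a) \<Rightarrow> (nat \<Rightarrow> 'a) set" where
  "solenoid B r = {x. \<forall>n. x n \<in> space B \<and> r (x (Suc n)) = x n}"

definition theta :: "nat \<Rightarrow> (nat \<Rightarrow> 'a) \<Rightarrow> 'a" where
  "theta n x = x n"

text \<open>Only the underlying measurable space of \<open>solenoid_algebra B r\<close> is used.\<close>

definition solenoid_algebra :: "'a measure \<Rightarrow> ('a \<Rightarrow> 'a) \<Rightarrow> (nat \<Rightarrow> 'a) measure" where
  "solenoid_algebra B r =
     sigma (solenoid B r) {theta n -` A \<inter> solenoid B r | n A. A \<in> sets B}"

definition rhat :: "('a \<Rightarrow> 'a) \<Rightarrow> (nat \<Rightarrow> 'a) \<Rightarrow> nat \<Rightarrow> 'a" where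
  "rhat r x = case_nat (r (x 0)) x"

text \<open>The measure \<open>E \<mapsto> M (f ` E)\<close>. By the convention of \<^const>\<open>measure_of\<close> it is the zero measure
  when this set function is not a measure; \<open>emeasure_comp_rhat\<close> below shows that this does not
  occur for \<^const>\<open>rhat\<close>.\<close>

definition measure_comp :: "'a measure \<Rightarrow> ('a \<Rightarrow> 'a) \<Rightarrow> 'a measure" where
  "measure_comp M f = measure_of (space M) (sets M) (\<lambda>E. emeasure M (f ` E))"

lemma space_solenoid_algebra [simp]: "space (solenoid_algebra B r) = solenoid B r"
  unfolding solenoid_algebra_def by (rule space_measure_of) auto

lemma sets_solenoid_algebra:
  "sets (solenoid_algebra B r) =
     sigma_sets (solenoid B r) {theta n -` A \<inter> solenoid B r | n A. A \<in> sets B}"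
  unfolding solenoid_algebra_def by (rule sets_measure_of) auto

lemma theta_measurable: "theta n \<in> measurable (solenoid_algebra B r) B"
proof (rule measurableI)
  show "theta n x \<in> space B" if "x \<in> space (solenoid_algebra B r)" for x
    using that by (auto simp: solenoid_def theta_def)
  show "theta n -` A \<inter> space (solenoid_algebra B r) \<in> sets (solenoid_algebra B r)"
    if "A \<in> sets B" for A
    using that by (auto simp: sets_solenoid_algebra intro!: sigma_sets.Basic)
qed

lemma rhat_image:
  assumes r: "r \<in> measurable B B" and E: "E \<subseteq> solenoid B r"
  shows "rhat r ` E = (\<lambda>x n. x (Suc n)) -` E \<inter> solenoid B r"
proof (intro equalityI subsetI)
  fix z assume "z \<in> rhat r ` E"
  then obtain x where x: "x \<in> E" and z: "z = rhat r x" by blast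
  have "(\<lambda>n. z (Suc n)) = x" by (simp add: z rhat_def)
  moreover have "x n \<in> space B" "r (x (Suc n)) = x n" for n
    using x E by (auto simp: solenoid_def)
  then have "z \<in> solenoid B r"
    using measurable_space[OF r] by (auto simp: z solenoid_def rhat_def split: nat.split)
  ultimately show "z \<in> (\<lambda>x n. x (Suc n)) -` E \<inter> solenoid B r"
    using x by simp
next
  fix z assume z: "z \<in> (\<lambda>x n. x (Suc n)) -` E \<inter> solenoid B r"
  then have "z = rhat r (\<lambda>n. z (Suc n))"
    by (auto simp: fun_eq_iff solenoid_def rhat_def split: nat.split)
  with z show "z \<in> rhat r ` E" by blast
qed

lemma shift_measurable:
  "(\<lambda>x n. x (Suc n)) \<in> measurable (solenoid_algebra B r) (solenoid_algebra B r)"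
proof -
  have "(\<lambda>x n. x (Suc n)) \<in> measurable (solenoid_algebra B r)
      (sigma (solenoid B r) {theta n -` A \<inter> solenoid B r | n A. A \<in> sets B})"
  proof (rule measurable_measure_of)
    show sp: "(\<lambda>x n. x (Suc n)) \<in> space (solenoid_algebra B r) \<rightarrow> solenoid B r"
      by (auto simp: solenoid_def)
    fix Y assume "Y \<in> {theta n -` A \<inter> solenoid B r | n A. A \<in> sets B}"
    then obtain n A where Y: "Y = theta n -` A \<inter> solenoid B r" "A \<in> sets B" by blast
    have "(\<lambda>x n. x (Suc n)) -` Y \<inter> space (solenoid_algebra B r) =
        theta (Suc n) -` A \<inter> space (solenoid_algebra B r)"
      using sp unfolding Y(1) by (auto simp: theta_def)
    then show "(\<lambda>x n. x (Suc n)) -` Y \<inter> space (solenoid_algebra B r)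
        \<in> sets (solenoid_algebra B r)"
      using measurable_sets[OF theta_measurable Y(2)] by metis
  qed auto
  then show ?thesis by (simp only: solenoid_algebra_def [symmetric])
qed

lemma measure_comp_rhat:
  assumes r: "r \<in> measurable B B" and M: "sets M = sets (solenoid_algebra B r)"
  shows "measure_comp M (rhat r) = distr M M (\<lambda>x n. x (Suc n))"
proof -
  have sp: "space M = solenoid B r" using sets_eq_imp_space_eq[OF M] by simp
  have "emeasure M (rhat r ` E) = emeasure M ((\<lambda>x n. x (Suc n)) -` E \<inter> space M)"
    if "E \<in> sets M" for E
    using rhat_image[OF r, of E] sets.sets_into_space[OF that] sp by simp
  then show ?thesis unfolding measure_comp_def distr_def
    by (intro measure_of_eq) (auto simp: sets.space_closed sets.sigma_sets_eq)
qed

lemma emeasure_comp_rhat: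
  assumes r: "r \<in> measurable B B" and M: "sets M = sets (solenoid_algebra B r)"
    and E: "E \<in> sets M"
  shows "emeasure (measure_comp M (rhat r)) E = emeasure M (rhat r ` E)"
proof -
  have sp: "space M = solenoid B r" using sets_eq_imp_space_eq[OF M] by simp
  have "(\<lambda>x n. x (Suc n)) \<in> measurable M M"
    using shift_measurable measurable_cong_sets[OF M M] by blast
  then show ?thesis
    using rhat_image[OF r, of E] sets.sets_into_space[OF E] sp E
    by (simp add: measure_comp_rhat[OF r M] emeasure_distr)
qed

end

theory Submission imports Defs begin

text \<open>Existence: writing \<open>y = T (N y) (r y)\<close>, where \<open>N y\<close> is the index of the inverse branch through \<open>y\<close>,
  reduces the disintegration of \<open>V d\<mu>\<^sub>0\<close> along \<open>r\<close> to a conditional law of the integer \<open>N\<close> given \<open>r\<close>,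
  for which Radon--Nikodym densities suffice on any measurable space. Choosing the branch at
  random by this law gives a Markov chain of iterated preimages started in \<open>\<mu>\<^sub>0\<close>; its law is
  \<open>\<mu>\<close>. One step of the chain turns \<open>\<mu>\<^sub>0\<close> into \<open>V d\<mu>\<^sub>0\<close>, and dropping the first coordinate of a path
  restarts the chain after one step, so the shift carries \<open>\<mu>\<close> to \<open>(V \<circ> \<theta>\<^sub>0) d\<mu>\<close>. The solenoid need not
  be measurable in the product space, so the chain is realised as a map into the solenoid driven
  by independent uniform variables rather than by restricting a measure on the product.

  Uniqueness: by the density equation the law of \<open>\<theta>\<^sub>n\<^sub>+\<^sub>1\<close> has density \<open>V \<circ> r\<^sup>n\<close> with respect to the law
  of \<open>\<theta>\<^sub>n\<close>, and the sets \<open>\<theta>\<^sub>n\<^sup>-\<^sup>1(A)\<close> form an intersection-stable generator because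
  \<open>\<theta>\<^sub>m = r\<^sup>k \<circ> \<theta>\<^sub>m\<^sub>+\<^sub>k\<close>.\<close>

section \<open>Measurable labelling of the inverse branches\<close>

text \<open>Encodes a point by its branch index and its image, with branches extended to total maps.
  Finiteness of the fibres and surjectivity of \<open>r\<close> make branch 1 available over every
  point.\<close>

lemma branches_section:
  assumes r: "r \<in> measurable B B" "r ` space B = space B"
    and fin: "\<And>x. x \<in> space B \<Longrightarrow> finite (fibre B r x)"
    and br: "measurable_branches B r"
  obtains N :: "'a \<Rightarrow> nat" and T :: "nat \<Rightarrow> 'a \<Rightarrow> 'a"
  where "N \<in> measurable B (count_space UNIV)" "\<And>i. T i \<in> measurable B B"
    "\<And>x i. x \<in> space B \<Longrightarrow> r (T i x) = x" "\<And>y. y \<in> space B \<Longrightarrow> T (N y) (r y) = y"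
proof -
  let ?c = "fibre_card B r" and ?A = "fibre_ge B r"
  from br obtain \<tau> :: "nat \<Rightarrow> 'a \<Rightarrow> 'a" where
    c: "?c \<in> measurable B (count_space UNIV)" and
    \<tau>: "\<And>i. i \<ge> 1 \<Longrightarrow> \<tau> i \<in> measurable (restrict_space B (?A i)) B"
      "\<And>i. i \<ge> 1 \<Longrightarrow> \<tau> i ` ?A i \<in> sets B"
      "\<And>x. x \<in> space B \<Longrightarrow> bij_betw (\<lambda>i. \<tau> i x) {1..?c x} (fibre B r x)"
    unfolding measurable_branches_def by blast
  have A: "{x \<in> space B. i \<le> ?c x} \<in> sets B" for i
    using measurable_sets[OF c, of "{i..}"] by (simp add: vimage_def Int_def conj_commute)
  have c1: "1 \<le> ?c x" if x: "x \<in> space B" for x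
  proof -
    from x r(2) obtain y where "y \<in> space B" "r y = x" by (metis imageE)
    then have "fibre B r x \<noteq> {}" by (auto simp: fibre_def)
    then show ?thesis using fin[OF x] by (simp add: fibre_card_def Suc_le_eq card_gt_0_iff)
  qed
  \<comment> \<open>Out-of-range indices are sent to branch 1, so that every index sequence gives a point of the
    solenoid, with no exceptional null set.\<close>
  define T where "T i x = (if 1 \<le> i \<and> i \<le> ?c x then \<tau> i x else \<tau> 1 x)" for i x
  \<comment> \<open>The index is determined by \<open>y\<close>: \<open>y = \<tau> i x\<close>
    forces \<open>x = r y\<close>, and the branches over \<open>r y\<close> do not repeat. Writing
    it with \<open>LEAST\<close> reduces measurability to that of the branch images.\<close>
  define N where "N y = (LEAST i. 1 \<le> i \<and> y \<in> \<tau> i ` ?A i)" for y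
  have T_fibre: "T i x \<in> fibre B r x" if x: "x \<in> space B" for i x
  proof -
    have "\<tau> j x \<in> fibre B r x" if "1 \<le> j" "j \<le> ?c x" for j
      using bij_betw_apply[OF \<tau>(3)[OF x], of j] that by simp
    then show ?thesis using c1[OF x] by (simp add: T_def)
  qed
  have \<tau>_fibre: "r (\<tau> i x) = x" if "1 \<le> i" "x \<in> ?A i" for i x
    using T_fibre[of x i] that by (auto simp: T_def fibre_ge_def fibre_def)
  have N: "1 \<le> N y \<and> y \<in> \<tau> (N y) ` ?A (N y)" if y: "y \<in> space B" for y
  proof -
    have x: "r y \<in> space B" using measurable_space[OF r(1) y] .
    have "y \<in> fibre B r (r y)" using y by (simp add: fibre_def)
    then obtain i where "i \<in> {1..?c (r y)}" "y = \<tau> i (r y)"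
      using bij_betw_imp_surj_on[OF \<tau>(3)[OF x]] by (metis (no_types, lifting) imageE)
    with x have "1 \<le> i \<and> y \<in> \<tau> i ` ?A i" by (auto simp: fibre_ge_def)
    then show ?thesis unfolding N_def by (rule LeastI)
  qed
  show thesis
  proof
    have "Measurable.pred B (\<lambda>y. 1 \<le> i \<and> y \<in> \<tau> i ` ?A i)" for i
    proof (cases "1 \<le> i")
      case True
      then show ?thesis using \<tau>(2)[OF True]
        by simp
    qed simp
    then show "N \<in> measurable B (count_space UNIV)"
      unfolding N_def by (rule measurable_Least)
    show "T i \<in> measurable B B" for i
    proof -
      have \<tau>1: "\<tau> 1 \<in> measurable B B"
      proof -
        have "?A 1 = space B" using c1 by (auto simp: fibre_ge_def)
        then have "sets (restrict_space B (?A 1)) = sets B"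
          by (auto simp: sets_restrict_space_iff) (use sets.sets_into_space in blast)
        then show ?thesis using \<tau>(1)[of 1] measurable_cong_sets by blast
      qed
      show ?thesis
      proof (cases "1 \<le> i")
        case True
        \<comment> \<open>The criterion for a case distinction restricts to a set in the whole type;
          a restricted space sees only the trace on \<open>space B\<close>, which is
          \<open>?A i\<close>.\<close>
        have eq: "{x. i \<le> ?c x} \<inter> space B = ?A i" by (auto simp: fibre_ge_def)
        have "restrict_space B {x. i \<le> ?c x} = restrict_space B (?A i)"
          unfolding eq[symmetric] restrict_space_def
          by (intro arg_cong2[where f = "\<lambda>a b. measure_of a b (emeasure B)"] image_cong)
            (use sets.sets_into_space in blast)+
        then have "(\<lambda>x. if i \<le> ?c x then \<tau> i x else \<tau> 1 x) \<in> measurable B B"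
          using \<tau>(1)[OF True] \<tau>1 A[of i]
          by (subst measurable_If_restrict_space_iff)
            (auto intro: measurable_restrict_space1 simp: pred_def)
        then show ?thesis using True by (simp add: T_def[abs_def])
      next
        case False
        then show ?thesis using \<tau>1 by (simp add: T_def[abs_def])
      qed
    qed
    show "r (T i x) = x" if "x \<in> space B" for x i
      using T_fibre[OF that, of i] by (simp add: fibre_def)
    show "T (N y) (r y) = y" if "y \<in> space B" for y
    proof -
      from N[OF that] obtain x where "1 \<le> N y" "x \<in> ?A (N y)" "y = \<tau> (N y) x" by blast
      then show ?thesis using \<tau>_fibre[of "N y" x] by (simp add: T_def fibre_ge_def)
    qed
  qed
qed

section \<open>Sampling a branch index from its conditional law\<close>

text \<open>The right endpoint is left out so that, for weights of total 1, every sample is exceeded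
  by some partial sum.\<close>

abbreviation unif :: "real measure" where
  "unif \<equiv> uniform_measure lborel {0..<1}"

lemma prob_space_unif: "prob_space unif"
  by (rule prob_space_uniform_measure) auto

text \<open>Inverse transform sampling: \<open>q\<close> is the generalised inverse of the
  distribution function of the weights, and the samples it sends to \<open>i\<close> fill a
  half-open interval of length \<open>w i\<close>.\<close>

lemma uniform_inverse_cdf:
  fixes w :: "nat \<Rightarrow> ennreal"
  assumes w: "(\<Sum>i. w i) = 1"
  defines "q u \<equiv> LEAST i. ennreal u < (\<Sum>j\<le>i. w j)"
  shows "(\<integral>\<^sup>+u. f (q u) \<partial>unif) = (\<Sum>i. w i * f i)"
proof -
  \<comment> \<open>\<open>S i\<close> stops below \<open>i\<close> while the sums in
    \<open>q\<close> include \<open>i\<close>; the interval of \<open>i\<close> thus runs from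
    \<open>S i\<close> to \<open>S (Suc i)\<close>, starting at \<open>S 0 = 0\<close>.\<close>
  define S where "S i = (\<Sum>j<i. w j)" for i
  have S_mono: "S i \<le> S j" if "i \<le> j" for i j
    unfolding S_def by (rule sum_mono2) (use that in auto)
  have S1: "S i \<le> 1" for i
    unfolding S_def w[symmetric] by (rule sum_le_suminf) auto
  have Sfin: "S i < \<top>" for i using S1[of i] by (simp add: order_le_less_trans)
  have S_Suc: "(\<Sum>j\<le>i. w j) = S (Suc i)" for i
    by (simp add: S_def lessThan_Suc_atMost)
  have q: "q u = i \<longleftrightarrow> u \<in> {enn2real (S i)..<enn2real (S (Suc i))}" if u: "u \<in> {0..<1}" for u i
  proof -
    have less: "ennreal u < S j \<longleftrightarrow> u < enn2real (S j)" for j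
      using u Sfin[of j] by (metis atLeastLessThan_iff ennreal_enn2real ennreal_less_iff)
    have "\<exists>j. ennreal u < S j"
    proof (rule ccontr)
      assume "\<nexists>j. ennreal u < S j"
      then have "(\<Sum>i. w i) \<le> ennreal u"
        unfolding S_def by (intro suminf_le_const) (auto simp: not_less)
      then show False using u w by (simp add: ennreal_ge_1)
    qed
    then obtain j where "ennreal u < S j" by blast
    \<comment> \<open>The \<open>LEAST\<close> in \<open>q\<close> searches among the sums
      \<open>S (Suc i)\<close>, so the witness moves up by one.\<close>
    moreover have "S j \<le> S (Suc j)" by (rule S_mono) simp
    ultimately have "ennreal u < S (Suc j)" by (rule order_less_le_trans)
    then have L: "ennreal u < S (Suc (q u))"
      unfolding q_def S_Suc by (rule LeastI)
    have L2: "S i \<le> ennreal u" if "i \<le> q u" for i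
    proof (cases i)
      case 0 then show ?thesis by (simp add: S_def)
    next
      case (Suc l)
      then show ?thesis using not_less_Least[of l "\<lambda>i. ennreal u < S (Suc i)"] that
        by (simp add: q_def S_Suc not_less)
    qed
    have "q u = i" if "S i \<le> ennreal u" "ennreal u < S (Suc i)"
    proof (rule antisym)
      show "q u \<le> i" using that(2) unfolding q_def S_Suc by (rule Least_le)
      show "i \<le> q u"
      proof (rule ccontr)
        assume "\<not> i \<le> q u"
        then have "S (Suc (q u)) \<le> S i" by (intro S_mono) simp
        then show False using L that(1) by (meson leD order_less_le_trans order_trans)
      qed
    qed
    then show ?thesis using L L2[of i] less by (auto simp: not_less[symmetric])
  qed
  have [measurable]: "q \<in> measurable borel (count_space UNIV)"
    unfolding q_def by measurable
  have "(\<integral>\<^sup>+u. f (q u) \<partial>unif) = (\<integral>\<^sup>+u. f (q u) * indicator {0..<1} u \<partial>lborel)"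
    by (subst uniform_measure_def, subst nn_integral_density)
      (auto intro!: nn_integral_cong simp: indicator_def)
  also have "\<dots> = (\<integral>\<^sup>+u. (\<Sum>i. f i * indicator {enn2real (S i)..<enn2real (S (Suc i))} u) \<partial>lborel)"
  proof (rule nn_integral_cong)
    fix u :: real
    show "f (q u) * indicator {0..<1} u
      = (\<Sum>i. f i * indicator {enn2real (S i)..<enn2real (S (Suc i))} u)"
    proof (cases "u \<in> {0..<1}")
      case True
      then have "(\<Sum>i. f i * indicator {enn2real (S i)..<enn2real (S (Suc i))} u)
        = (\<Sum>i. if i = q u then f i else 0)"
        by (intro suminf_cong) (auto simp: indicator_def q[OF True, symmetric] simp del: atLeastLessThan_iff)
      also have "\<dots> = f (q u)" 
        using sums_unique[OF sums_single[of "q u" f]] by simp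
      finally show ?thesis using True by simp
    next
      case False
      have "0 \<le> enn2real (S i)" "enn2real (S i) \<le> 1" for i
        using S1[of i] by (auto simp: enn2real_leI)
      then have "u \<notin> {enn2real (S i)..<enn2real (S (Suc i))}" for i
        using False by (meson atLeastLessThan_iff order_trans order_less_le_trans)
      then show ?thesis using False by simp
    qed
  qed
  also have "\<dots> = (\<Sum>i. f i * emeasure lborel {enn2real (S i)..<enn2real (S (Suc i))})"
    by (subst nn_integral_suminf) (auto simp: nn_integral_cmult)
  also have "\<dots> = (\<Sum>i. w i * f i)"
  proof (intro suminf_cong)
    fix i
    have wi: "w i < \<top>" using Sfin[of "Suc i"] by (simp add: S_def)
    have "enn2real (S (Suc i)) = enn2real (S i) + enn2real (w i)"
      using enn2real_plus[OF Sfin wi] by (simp add: S_def)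
    then show "f i * emeasure lborel {enn2real (S i)..<enn2real (S (Suc i))} = w i * f i"
      using wi by (simp add: mult.commute)
  qed
  finally show ?thesis .
qed

text \<open>Drawing \<open>x\<close> from the push-forward and then an index from its conditional
  law given \<open>r = x\<close> reproduces the joint law of \<open>N\<close> and \<open>r\<close>.
  One measurable \<open>q\<close> serves all integrands, so it can drive a Markov chain.\<close>

lemma randomised_disintegration:
  fixes N :: "'b \<Rightarrow> nat"
  assumes r[measurable]: "r \<in> measurable M B" and N[measurable]: "N \<in> measurable M (count_space UNIV)"
    and fin: "finite_measure (distr M B r)"
  obtains q where "q \<in> measurable (B \<Otimes>\<^sub>M borel) (count_space UNIV)"
    "\<And>h. (\<And>i::nat. h i \<in> borel_measurable B) \<Longrightarrow>
       (\<integral>\<^sup>+y. h (N y) (r y) \<partial>M) = (\<integral>\<^sup>+x. (\<integral>\<^sup>+u. h (q (x, u)) x \<partial>unif) \<partial>distr M B r)"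
proof -
  let ?M = "distr M B r"
  interpret finite_measure ?M by fact
  \<comment> \<open>The part of \<open>M\<close> with index \<open>i\<close>, pushed to the base. It
    is dominated by \<open>?M\<close>, and its density \<open>w i\<close> is the conditional
    probability of \<open>N = i\<close>.\<close>
  define \<nu> where "\<nu> i = distr (density M (indicator {y. N y = i})) B r" for i
  have \<nu>: "(\<integral>\<^sup>+x. g x \<partial>\<nu> i) = (\<integral>\<^sup>+y. indicator {y. N y = i} y * g (r y) \<partial>M)"
    if [measurable]: "g \<in> borel_measurable B" for g i
    unfolding \<nu>_def by (simp add: nn_integral_distr nn_integral_density)
  have split: "(\<integral>\<^sup>+y. h (N y) (r y) \<partial>M) = (\<Sum>i. \<integral>\<^sup>+x. h i x \<partial>\<nu> i)"
    if [measurable]: "\<And>i. h i \<in> borel_measurable B" for h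
  proof -
    have "h (N y) (r y) = (\<Sum>i. indicator {y. N y = i} y * h i (r y))" for y
    proof -
      have "(\<Sum>i. indicator {y. N y = i} y * h i (r y)) = (\<Sum>i\<in>{N y}. indicator {y. N y = i} y * h i (r y))"
        by (rule suminf_finite) auto
      then show ?thesis by simp
    qed
    then show ?thesis by (simp add: \<nu> nn_integral_suminf)
  qed
  have "\<exists>w\<in>borel_measurable ?M. density ?M w = \<nu> i" for i
  proof (rule Radon_Nikodym)
    show "sets (\<nu> i) = sets ?M" by (simp add: \<nu>_def)
    show "absolutely_continuous ?M (\<nu> i)" unfolding absolutely_continuous_def
    proof
      fix E assume E: "E \<in> null_sets ?M"
      then have [measurable]: "E \<in> sets B" and 0: "emeasure M (r -` E \<inter> space M) = 0"
        by (auto simp: null_sets_def emeasure_distr)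
      have "emeasure (\<nu> i) E = (\<integral>\<^sup>+x. indicator E x \<partial>\<nu> i)"
        by (simp add: \<nu>_def)
      also have "\<dots> \<le> (\<integral>\<^sup>+y. indicator (r -` E \<inter> space M) y \<partial>M)"
        by (subst \<nu>) (auto intro!: nn_integral_mono simp: indicator_def simp del: nn_integral_indicator)
      also have "\<dots> = 0" using 0 by simp
      finally show "E \<in> null_sets (\<nu> i)" by (simp add: null_sets_def \<nu>_def)
    qed
  qed
  then obtain w where w': "\<And>i. w i \<in> borel_measurable ?M" and dens: "\<And>i. density ?M (w i) = \<nu> i"
    by metis
  then have w[measurable]: "w i \<in> borel_measurable B" for i by simp
  have \<nu>w: "(\<integral>\<^sup>+x. g x \<partial>\<nu> i) = (\<integral>\<^sup>+x. w i x * g x \<partial>?M)" if "g \<in> borel_measurable B" for g i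
    using that unfolding dens[symmetric] by (simp add: nn_integral_density)
  \<comment> \<open>Summing over \<open>i\<close> forgets the index, so the measures
    \<open>\<nu> i\<close> add up to \<open>?M\<close>.\<close>
  have "density ?M (\<lambda>x. \<Sum>i. w i x) = density ?M (\<lambda>x. 1)"
  proof (rule measure_eqI)
    fix E assume "E \<in> sets (density ?M (\<lambda>x. \<Sum>i. w i x))"
    then have [measurable]: "E \<in> sets B" by simp
    have "emeasure (density ?M (\<lambda>x. \<Sum>i. w i x)) E = (\<Sum>i. \<integral>\<^sup>+x. w i x * indicator E x \<partial>?M)"
      by (simp add: emeasure_density nn_integral_suminf[symmetric] del: nn_integral_indicator)
    also have "\<dots> = (\<Sum>i. \<integral>\<^sup>+x. indicator E x \<partial>\<nu> i)"
      by (simp add: \<nu>w del: nn_integral_indicator)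
    also have "\<dots> = (\<integral>\<^sup>+y. indicator E (r y) \<partial>M)"
      by (rule split[symmetric]) simp
    also have "\<dots> = emeasure ?M E"
      by (simp add: nn_integral_distr[symmetric, of r M B "indicator E"])
    finally show "emeasure (density ?M (\<lambda>x. \<Sum>i. w i x)) E = emeasure (density ?M (\<lambda>x. 1)) E"
      by (simp add: density_1)
  qed simp
  then have sum_w: "AE x in ?M. (\<Sum>i. w i x) = 1"
    by (intro density_unique) auto
  \<comment> \<open>Where the weights do not sum to 1, \<open>LEAST\<close> may return a default
    value; this happens on a null set only, and \<open>q\<close> is measurable there too.\<close>
  define q where "q = (\<lambda>p. LEAST i. ennreal (snd p) < (\<Sum>j\<le>i. w j (fst p)))"
  show thesis
  proof
    show "q \<in> measurable (B \<Otimes>\<^sub>M borel) (count_space UNIV)"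
      unfolding q_def by measurable
    fix h :: "nat \<Rightarrow> 'a \<Rightarrow> ennreal" assume h[measurable]: "\<And>i. h i \<in> borel_measurable B"
    have "(\<integral>\<^sup>+x. (\<integral>\<^sup>+u. h (q (x, u)) x \<partial>unif) \<partial>?M) = (\<integral>\<^sup>+x. (\<Sum>i. w i x * h i x) \<partial>?M)"
    proof (rule nn_integral_cong_AE)
      show "AE x in ?M. (\<integral>\<^sup>+u. h (q (x, u)) x \<partial>unif) = (\<Sum>i. w i x * h i x)"
        using sum_w
      proof eventually_elim
        case (elim x)
        then show ?case
          using uniform_inverse_cdf[of "\<lambda>i. w i x" "\<lambda>i. h i x"] by (simp add: q_def)
      qed
    qed
    also have "\<dots> = (\<Sum>i. \<integral>\<^sup>+x. h i x \<partial>\<nu> i)"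
      by (simp add: \<nu>w nn_integral_suminf)
    finally show "(\<integral>\<^sup>+y. h (N y) (r y) \<partial>M) = (\<integral>\<^sup>+x. (\<integral>\<^sup>+u. h (q (x, u)) x \<partial>unif) \<partial>?M)"
      using split[OF h] by simp
  qed
qed

section \<open>Paths of iterated preimages\<close>

text \<open>The recursion consumes the first random input first, so that dropping the first
  coordinate of a path means, by definition, restarting at \<open>G x (shd \<omega>)\<close> with
  the inputs \<open>stl \<omega>\<close>.\<close>

primrec walk :: "('a \<Rightarrow> 'b \<Rightarrow> 'a) \<Rightarrow> nat \<Rightarrow> 'a \<Rightarrow> 'b stream \<Rightarrow> 'a" where
  "walk G 0 x \<omega> = x"
| "walk G (Suc n) x \<omega> = walk G n (G x (shd \<omega>)) (stl \<omega>)"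

lemma measurable_walk:
  assumes G[measurable]: "case_prod G \<in> measurable (B \<Otimes>\<^sub>M U) B"
  shows "(\<lambda>(x, \<omega>). walk G n x \<omega>) \<in> measurable (B \<Otimes>\<^sub>M stream_space U) B"
proof (induction n)
  case (Suc n)
  note Suc[measurable]
  have "(\<lambda>p. (G (fst p) (shd (snd p)), stl (snd p))) \<in> measurable (B \<Otimes>\<^sub>M stream_space U) (B \<Otimes>\<^sub>M stream_space U)"
    by measurable
  from measurable_compose[OF this Suc] show ?case by (simp add: case_prod_beta)
qed simp

text \<open>Consecutive positions are linked by \<open>r (G x u) = x\<close>; as this holds for all
  inputs, every path lies in the solenoid and not just almost every one.\<close>

lemma walk_solenoid:
  assumes G: "case_prod G \<in> measurable (B \<Otimes>\<^sub>M U) B" and rG: "\<And>x u. x \<in> space B \<Longrightarrow> r (G x u) = x"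
    and x: "x \<in> space B" and \<omega>: "\<omega> \<in> streams (space U)"
  shows "(\<lambda>n. walk G n x \<omega>) \<in> solenoid B r"
proof -
  have "walk G n x \<omega> \<in> space B \<and> r (walk G (Suc n) x \<omega>) = walk G n x \<omega>" for n
    using x \<omega>
  \<comment> \<open>The recursion changes both the start and the inputs.\<close>
  proof (induction n arbitrary: x \<omega>)
    case 0
    then show ?case by (simp add: rG)
  next
    case (Suc n)
    have "shd \<omega> \<in> space U" "stl \<omega> \<in> streams (space U)"
      using Suc.prems(2) by (cases \<omega>; simp)+
    moreover from this have "G x (shd \<omega>) \<in> space B"
      using measurable_space[OF G, of "(x, shd \<omega>)"] Suc.prems(1) by (simp add: space_pair_measure)
    ultimately show ?case using Suc.IH[of "G x (shd \<omega>)" "stl \<omega>"] by simp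
  qed
  then show ?thesis unfolding solenoid_def by blast
qed

lemma measurable_solenoid_algebra:
  assumes "\<And>x. x \<in> space M \<Longrightarrow> f x \<in> solenoid B r"
    and "\<And>n. (\<lambda>x. f x n) \<in> measurable M B"
  shows "f \<in> measurable M (solenoid_algebra B r)"
  unfolding solenoid_algebra_def
proof (rule measurable_measure_of)
  fix Y assume "Y \<in> {theta n -` A \<inter> solenoid B r | n A. A \<in> sets B}"
  then obtain n A where Y: "Y = theta n -` A \<inter> solenoid B r" "A \<in> sets B" by blast
  then have "f -` Y \<inter> space M = (\<lambda>x. f x n) -` A \<inter> space M"
    using assms(1) by (auto simp: theta_def)
  then show "f -` Y \<inter> space M \<in> sets M"
    using measurable_sets[OF assms(2) Y(2)] by simp
qed (use assms(1) in auto)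

section \<open>Coordinate laws determine the measure\<close>

lemma solenoid_theta:
  assumes "x \<in> solenoid B r"
  shows "(r ^^ k) (theta (n + k) x) = theta n x"
  using assms by (induction k arbitrary: n) (auto simp: solenoid_def theta_def funpow_swap1)

text \<open>A pi-lambda argument. Each coordinate determines all earlier ones, so one-coordinate
  laws take the place of joint laws.\<close>

lemma solenoid_measure_eqI:
  fixes \<mu> \<nu> :: "(nat \<Rightarrow> 'a) measure"
  assumes r[measurable]: "r \<in> measurable B B"
    and s: "sets \<mu> = sets (solenoid_algebra B r)" "sets \<nu> = sets (solenoid_algebra B r)"
    and fin: "finite_measure \<mu>"
    and eq: "\<And>n A. A \<in> sets B \<Longrightarrow>
      emeasure \<mu> (theta n -` A \<inter> solenoid B r) = emeasure \<nu> (theta n -` A \<inter> solenoid B r)"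
  shows "\<mu> = \<nu>"
proof -
  let ?E = "{theta n -` A \<inter> solenoid B r | n A. A \<in> sets B}"
  have sp: "space \<mu> = solenoid B r" using sets_eq_imp_space_eq[OF s(1)] by simp
  have raise: "theta n -` A \<inter> solenoid B r =
      theta (n + k) -` ((r ^^ k) -` A \<inter> space B) \<inter> solenoid B r" for n k A
  proof -
    have "theta (n + k) x \<in> space B" if "x \<in> solenoid B r" for x
      using that by (simp add: solenoid_def theta_def)
    then show ?thesis using solenoid_theta[of _ B r k n] by auto
  qed
  have raise_sets: "(r ^^ k) -` A \<inter> space B \<in> sets B" if "A \<in> sets B" for k A
    using measurable_sets[OF _ that, of "r ^^ k" B] by (simp add: r)
  have "Int_stable ?E"
  proof (rule Int_stableI, clarsimp)
    fix m n A A' assume A: "A \<in> sets B" "A' \<in> sets B"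
    \<comment> \<open>Both sets are carried to coordinate \<open>m + n\<close>: the condition on
      coordinate \<open>m\<close> is pulled back \<open>n\<close> times, the one on \<open>n\<close>
      is pulled back \<open>m\<close> times.\<close>
    let ?A = "((r ^^ n) -` A \<inter> space B) \<inter> ((r ^^ m) -` A' \<inter> space B)"
    have "theta m -` A \<inter> solenoid B r \<inter> (theta n -` A' \<inter> solenoid B r) =
      theta (m + n) -` ?A \<inter> solenoid B r"
      using raise[of m A n] raise[of n A' m] by (auto simp: add.commute)
    moreover have "?A \<in> sets B" using A by (intro sets.Int raise_sets)
    ultimately show "\<exists>l C. theta m -` A \<inter> solenoid B r \<inter> (theta n -` A' \<inter> solenoid B r) =
      theta l -` C \<inter> solenoid B r \<and> C \<in> sets B" by blast
  qed
  then show ?thesis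
  proof (rule measure_eqI_generator_eq[where \<Omega> = "solenoid B r" and A = "\<lambda>_. solenoid B r"])
    show "?E \<subseteq> Pow (solenoid B r)" by auto
    show "emeasure \<mu> X = emeasure \<nu> X" if "X \<in> ?E" for X using that eq by auto
    show "sets \<mu> = sigma_sets (solenoid B r) ?E" "sets \<nu> = sigma_sets (solenoid B r) ?E"
      using s by (simp_all add: sets_solenoid_algebra)
    \<comment> \<open>The solenoid is itself a generator set of finite measure, so a constant
      sequence exhausts it.\<close>
    have "theta 0 -` space B \<inter> solenoid B r = solenoid B r"
      by (auto simp: solenoid_def theta_def)
    then show "range (\<lambda>_. solenoid B r) \<subseteq> ?E"
      by (auto intro!: exI[of _ 0] exI[of _ "space B"])
    show "emeasure \<mu> (solenoid B r) \<noteq> \<infinity>"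
      using finite_measure.emeasure_finite[OF fin] by simp
  qed auto
qed

text \<open>Lowering the coordinate by one trades \<open>g\<close> for its product with
  \<open>V\<close> after \<open>r ^^ n\<close>; the induction on \<open>n\<close> therefore varies
  \<open>g\<close> and ends at the common law of coordinate 0.\<close>

lemma nn_integral_theta_unique:
  fixes V :: "'a \<Rightarrow> real"
  assumes r[measurable]: "r \<in> measurable B B" and V[measurable]: "V \<in> borel_measurable B"
    and s: "sets \<mu> = sets (solenoid_algebra B r)" "sets \<nu> = sets (solenoid_algebra B r)"
    and c: "measure_comp \<mu> (rhat r) = density \<mu> (\<lambda>x. ennreal (V (theta 0 x)))"
      "measure_comp \<nu> (rhat r) = density \<nu> (\<lambda>x. ennreal (V (theta 0 x)))"
    and t: "distr \<mu> B (theta 0) = distr \<nu> B (theta 0)"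
    and g: "g \<in> borel_measurable B"
  shows "(\<integral>\<^sup>+x. g (theta n x) \<partial>\<mu>) = (\<integral>\<^sup>+x. g (theta n x) \<partial>\<nu>)"
  using g
proof (induction n arbitrary: g)
  case 0
  have "theta 0 \<in> measurable \<mu> B" "theta 0 \<in> measurable \<nu> B"
    using theta_measurable[of 0 B r] measurable_cong_sets s by blast+
  then show ?case
    using 0 by (simp add: nn_integral_distr[symmetric, of "theta 0" _ B] t)
next
  case (Suc n)
  note Suc.prems[measurable]
  have step: "(\<integral>\<^sup>+x. g (theta (Suc n) x) \<partial>\<rho>) =
      (\<integral>\<^sup>+x. (\<lambda>y. ennreal (V ((r ^^ n) y)) * g y) (theta n x) \<partial>\<rho>)"
    if \<rho>: "sets \<rho> = sets (solenoid_algebra B r)"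
      "measure_comp \<rho> (rhat r) = density \<rho> (\<lambda>x. ennreal (V (theta 0 x)))" for \<rho>
  proof -
    have [measurable]: "theta k \<in> measurable \<rho> B" for k
      using theta_measurable[of k B r] measurable_cong_sets[OF \<rho>(1)] by blast
    have [measurable]: "(\<lambda>x n. x (Suc n)) \<in> measurable \<rho> \<rho>"
      using shift_measurable[of B r] measurable_cong_sets[OF \<rho>(1) \<rho>(1)] by blast
    \<comment> \<open>Coordinate \<open>Suc n\<close> is coordinate \<open>n\<close> of the shifted
      path. Images under \<open>rhat r\<close> are preimages under the shift, so the density
      equation describes the shifted law.\<close>
    have "(\<integral>\<^sup>+x. g (theta (Suc n) x) \<partial>\<rho>) = (\<integral>\<^sup>+x. g (theta n (\<lambda>n. x (Suc n))) \<partial>\<rho>)"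
      by (simp add: theta_def)
    also have "\<dots> = (\<integral>\<^sup>+x. g (theta n x) \<partial>distr \<rho> \<rho> (\<lambda>x n. x (Suc n)))"
      by (rule nn_integral_distr[symmetric]) measurable
    also have "\<dots> = (\<integral>\<^sup>+x. g (theta n x) \<partial>density \<rho> (\<lambda>x. ennreal (V (theta 0 x))))"
      using measure_comp_rhat[OF r \<rho>(1)] \<rho>(2) by simp
    also have "\<dots> = (\<integral>\<^sup>+x. ennreal (V (theta 0 x)) * g (theta n x) \<partial>\<rho>)"
      by (rule nn_integral_density) measurable
    \<comment> \<open>On the solenoid \<open>theta 0 x = (r ^^ n) (theta n x)\<close>, which turns
      the density into a function of coordinate \<open>n\<close>.\<close>
    also have "\<dots> = (\<integral>\<^sup>+x. (\<lambda>y. ennreal (V ((r ^^ n) y)) * g y) (theta n x) \<partial>\<rho>)"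
      using sets_eq_imp_space_eq[OF \<rho>(1)] solenoid_theta[of _ B r n 0]
      by (intro nn_integral_cong) simp
    finally show ?thesis .
  qed
  have "(\<lambda>y. ennreal (V ((r ^^ n) y)) * g y) \<in> borel_measurable B" by measurable
  from Suc.IH[OF this] show ?case unfolding step[OF s(1) c(1)] step[OF s(2) c(2)] .
qed

section \<open>The path law as the unique solution\<close>

theorem theorem5p8p2:
  fixes B :: "'a measure" and r :: "'a \<Rightarrow> 'a" and V :: "'a \<Rightarrow> real" and \<mu>\<^sub>0 :: "'a measure"
  assumes "space B \<noteq> {}"
    and "r \<in> measurable B B"
    and "r ` space B = space B"
    and "\<And>x. x \<in> space B \<Longrightarrow> finite (fibre B r x)"
    and "measurable_branches B r"
    and "V \<in> borel_measurable B"
    and "\<And>x. x \<in> space B \<Longrightarrow> 0 \<le> V x"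
    and "sets \<mu>\<^sub>0 = sets B"
    and "finite_measure \<mu>\<^sub>0"
    and "\<mu>\<^sub>0 = distr (density \<mu>\<^sub>0 (\<lambda>x. ennreal (V x))) B r"
  shows "\<exists>!\<mu> :: (nat \<Rightarrow> 'a) measure.
           sets \<mu> = sets (solenoid_algebra B r) \<and>
           finite_measure \<mu> \<and>
           measure_comp \<mu> (rhat r) = density \<mu> (\<lambda>x. ennreal (V (theta 0 x))) \<and>
           distr \<mu> B (theta 0) = \<mu>\<^sub>0"
proof -
  note r[measurable] = assms(2) and V[measurable] = assms(6)
  note s[measurable_cong] = assms(8) and fin = assms(9) and fp = assms(10)
  obtain N T where N: "N \<in> measurable B (count_space UNIV)" and T: "\<And>i::nat. T i \<in> measurable B B"
    and rT: "\<And>x i. x \<in> space B \<Longrightarrow> r (T i x) = x" and TN: "\<And>y. y \<in> space B \<Longrightarrow> T (N y) (r y) = y"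
    using branches_section[OF r assms(3-5)] by blast
  let ?M = "density \<mu>\<^sub>0 (\<lambda>x. ennreal (V x))"
  interpret \<mu>0: finite_measure \<mu>\<^sub>0 by fact
  interpret U: prob_space unif by (rule prob_space_unif)
  interpret S: prob_space "stream_space unif" by (rule U.prob_space_stream_space)
  have "r \<in> measurable ?M B" "N \<in> measurable ?M (count_space UNIV)"
    using N by measurable
  \<comment> \<open>By the fixed-point property \<open>?M\<close> is pushed to
    \<open>\<mu>\<^sub>0\<close> by \<open>r\<close>; the index law is therefore integrated against
    the starting law of the chain.\<close>
  then obtain q where q: "q \<in> measurable (B \<Otimes>\<^sub>M borel) (count_space UNIV)" and
    dis: "\<And>h. (\<And>i::nat. h i \<in> borel_measurable B) \<Longrightarrow>
       (\<integral>\<^sup>+y. h (N y) (r y) \<partial>?M) = (\<integral>\<^sup>+x. (\<integral>\<^sup>+u. h (q (x, u)) x \<partial>unif) \<partial>\<mu>\<^sub>0)"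
    using randomised_disintegration[of r ?M B N] fin unfolding fp[symmetric] by blast
  define G where "G x u = T (q (x, u)) x" for x u
  have "q \<in> measurable (B \<Otimes>\<^sub>M unif) (count_space UNIV)"
    using q by (simp cong: measurable_cong_sets sets_pair_measure_cong)
  from measurable_compose_countable[OF measurable_compose[OF measurable_fst T] this]
  have G[measurable]: "case_prod G \<in> measurable (B \<Otimes>\<^sub>M unif) B"
    by (simp add: G_def case_prod_beta')
  have rG: "r (G x u) = x" if "x \<in> space B" for x u using rT[OF that] by (simp add: G_def)
  \<comment> \<open>Disintegration with \<open>h i x = g (T i x)\<close>: the index and the image of
    \<open>y\<close> recombine to \<open>y\<close>.\<close>
  have trans: "(\<integral>\<^sup>+x. (\<integral>\<^sup>+u. g (G x u) \<partial>unif) \<partial>\<mu>\<^sub>0) = (\<integral>\<^sup>+x. ennreal (V x) * g x \<partial>\<mu>\<^sub>0)"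
    if g[measurable]: "g \<in> borel_measurable B" for g
  proof -
    have "(\<integral>\<^sup>+x. (\<integral>\<^sup>+u. g (G x u) \<partial>unif) \<partial>\<mu>\<^sub>0) = (\<integral>\<^sup>+y. g (T (N y) (r y)) \<partial>?M)"
      unfolding G_def using T by (intro dis[symmetric]) measurable
    also have "\<dots> = (\<integral>\<^sup>+y. g y \<partial>?M)"
      using TN sets_eq_imp_space_eq[OF s] by (intro nn_integral_cong) simp
    also have "\<dots> = (\<integral>\<^sup>+x. ennreal (V x) * g x \<partial>\<mu>\<^sub>0)"
      by (rule nn_integral_density) measurable
    finally show ?thesis .
  qed
  define \<Phi> where "\<Phi> = (\<lambda>(x, \<omega>) n. walk G n x \<omega>)"
  have \<Phi>_0: "theta 0 (\<Phi> (x, \<omega>)) = x" for x \<omega>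
    by (simp add: \<Phi>_def theta_def)
  have \<Phi>_Suc: "(\<lambda>n. \<Phi> (x, \<omega>) (Suc n)) = \<Phi> (G x (shd \<omega>), stl \<omega>)" for x \<omega>
    by (simp add: \<Phi>_def)
  define \<mu> where "\<mu> = distr (\<mu>\<^sub>0 \<Otimes>\<^sub>M stream_space unif) (solenoid_algebra B r) \<Phi>"
  have \<Phi>[measurable]: "\<Phi> \<in> measurable (B \<Otimes>\<^sub>M stream_space unif) (solenoid_algebra B r)"
  proof (rule measurable_solenoid_algebra)
    show "\<Phi> p \<in> solenoid B r" if "p \<in> space (B \<Otimes>\<^sub>M stream_space unif)" for p
      using that walk_solenoid[OF G rG]
      by (auto simp: \<Phi>_def space_pair_measure space_stream_space)
    show "(\<lambda>p. \<Phi> p n) \<in> measurable (B \<Otimes>\<^sub>M stream_space unif) B" for n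
      using measurable_walk[OF G, of n] by (simp add: \<Phi>_def case_prod_beta')
  qed
  have \<Phi>'[measurable]: "\<Phi> \<in> measurable (\<mu>\<^sub>0 \<Otimes>\<^sub>M stream_space unif) (solenoid_algebra B r)"
    by measurable
  have int\<mu>: "(\<integral>\<^sup>+z. f z \<partial>\<mu>) = (\<integral>\<^sup>+x. (\<integral>\<^sup>+\<omega>. f (\<Phi> (x, \<omega>)) \<partial>stream_space unif) \<partial>\<mu>\<^sub>0)"
    if [measurable]: "f \<in> borel_measurable (solenoid_algebra B r)" for f
    unfolding \<mu>_def by (subst nn_integral_distr) (simp_all add: S.nn_integral_fst[of "\<lambda>p. f (\<Phi> p)", symmetric])
  have s\<mu>: "sets \<mu> = sets (solenoid_algebra B r)" by (simp add: \<mu>_def)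
  note [measurable] = theta_measurable[of _ B r] shift_measurable[of B r]
  have th[measurable]: "theta n \<in> measurable \<mu> B" for n
    using theta_measurable[of n B r] by (simp add: \<mu>_def)
  have t0: "distr \<mu> B (theta 0) = \<mu>\<^sub>0"
  proof (rule measure_eqI)
    fix A assume "A \<in> sets (distr \<mu> B (theta 0))"
    then have [measurable]: "A \<in> sets B" by simp
    have "emeasure (distr \<mu> B (theta 0)) A = (\<integral>\<^sup>+z. indicator A (theta 0 z) \<partial>\<mu>)"
      by (subst nn_integral_distr[symmetric, of _ _ B]) auto
    also have "\<dots> = (\<integral>\<^sup>+x. (\<integral>\<^sup>+\<omega>. indicator A x \<partial>stream_space unif) \<partial>\<mu>\<^sub>0)"
      by (subst int\<mu>) (simp_all add: \<Phi>_0)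
    also have "\<dots> = emeasure \<mu>\<^sub>0 A" by (simp add: S.emeasure_space_1 s)
    finally show "emeasure (distr \<mu> B (theta 0)) A = emeasure \<mu>\<^sub>0 A" .
  qed (simp add: s)
  have finm: "finite_measure \<mu>"
  proof
    have "emeasure \<mu> (space \<mu>) = (\<integral>\<^sup>+z. 1 \<partial>\<mu>)" by simp
    also have "\<dots> = emeasure \<mu>\<^sub>0 (space \<mu>\<^sub>0)" by (subst int\<mu>) (simp_all add: S.emeasure_space_1)
    finally show "emeasure \<mu> (space \<mu>) \<noteq> \<infinity>" by simp
  qed
  have comp: "measure_comp \<mu> (rhat r) = density \<mu> (\<lambda>x. ennreal (V (theta 0 x)))"
    unfolding measure_comp_rhat[OF r s\<mu>]
  proof (rule measure_eqI)
    fix E assume "E \<in> sets (distr \<mu> \<mu> (\<lambda>x n. x (Suc n)))"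
    then have E[measurable]: "E \<in> sets (solenoid_algebra B r)" by (simp add: s\<mu>)
    have sh[measurable]: "(\<lambda>x n. x (Suc n)) \<in> measurable \<mu> \<mu>"
      using shift_measurable[of B r] by (simp add: measurable_cong_sets[OF s\<mu> s\<mu>])
    let ?f = "indicator E :: _ \<Rightarrow> ennreal"
    \<comment> \<open>The probability that a path started at \<open>x\<close> lies in
      \<open>E\<close>.\<close>
    define g where "g x = (\<integral>\<^sup>+\<omega>. ?f (\<Phi> (x, \<omega>)) \<partial>stream_space unif)" for x
    have g[measurable]: "g \<in> borel_measurable B" unfolding g_def by measurable
    have "emeasure (distr \<mu> \<mu> (\<lambda>x n. x (Suc n))) E = (\<integral>\<^sup>+z. ?f (\<lambda>n. z (Suc n)) \<partial>\<mu>)"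
    proof -
      have "?f \<in> borel_measurable \<mu>" using E by (intro borel_measurable_indicator) (simp add: s\<mu>)
      from nn_integral_distr[OF sh, of ?f] this show ?thesis by (simp add: E s\<mu>)
    qed
    also have "\<dots> = (\<integral>\<^sup>+x. (\<integral>\<^sup>+\<omega>. ?f (\<Phi> (G x (shd \<omega>), stl \<omega>)) \<partial>stream_space unif) \<partial>\<mu>\<^sub>0)"
      by (subst int\<mu>) (simp_all add: \<Phi>_Suc)
    \<comment> \<open>The first input is independent of the rest; integrating over the rest leaves
      \<open>g\<close> at the new position.\<close>
    also have "\<dots> = (\<integral>\<^sup>+x. (\<integral>\<^sup>+u. g (G x u) \<partial>unif) \<partial>\<mu>\<^sub>0)"
    proof (rule nn_integral_cong)
      fix x assume "x \<in> space \<mu>\<^sub>0"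
      then have x: "x \<in> space B" using sets_eq_imp_space_eq[OF s] by simp
      then have [measurable]: "G x \<in> measurable unif B"
        using measurable_compose[OF measurable_Pair1' G] by simp
      show "(\<integral>\<^sup>+\<omega>. ?f (\<Phi> (G x (shd \<omega>), stl \<omega>)) \<partial>stream_space unif) = (\<integral>\<^sup>+u. g (G x u) \<partial>unif)"
        unfolding g_def by (subst U.nn_integral_stream_space) simp_all
    qed
    also have "\<dots> = (\<integral>\<^sup>+x. ennreal (V x) * g x \<partial>\<mu>\<^sub>0)" by (rule trans) measurable
    \<comment> \<open>The factor \<open>V x\<close> depends only on the start of the path, that is,
      on \<open>theta 0\<close>, and so becomes a density on the solenoid.\<close>
    also have "\<dots> = (\<integral>\<^sup>+x. (\<integral>\<^sup>+\<omega>. ennreal (V x) * ?f (\<Phi> (x, \<omega>)) \<partial>stream_space unif) \<partial>\<mu>\<^sub>0)"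
      unfolding g_def by (intro nn_integral_cong nn_integral_cmult[symmetric]) measurable
    also have "\<dots> = (\<integral>\<^sup>+z. ennreal (V (theta 0 z)) * ?f z \<partial>\<mu>)"
      by (subst int\<mu>) (simp_all add: \<Phi>_0)
    also have "\<dots> = emeasure (density \<mu> (\<lambda>x. ennreal (V (theta 0 x)))) E"
      using E by (subst emeasure_density) (auto simp: s\<mu>)
    finally show "emeasure (distr \<mu> \<mu> (\<lambda>x n. x (Suc n))) E
      = emeasure (density \<mu> (\<lambda>x. ennreal (V (theta 0 x)))) E" .
  qed simp
  show ?thesis
  proof (rule ex1I[of _ \<mu>])
    fix \<nu> :: "(nat \<Rightarrow> 'a) measure"
    assume \<nu>: "sets \<nu> = sets (solenoid_algebra B r) \<and> finite_measure \<nu> \<and>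
      measure_comp \<nu> (rhat r) = density \<nu> (\<lambda>x. ennreal (V (theta 0 x))) \<and>
      distr \<nu> B (theta 0) = \<mu>\<^sub>0"
    show "\<nu> = \<mu>"
    proof (rule solenoid_measure_eqI[OF r])
      fix n A assume A: "A \<in> sets B"
      \<comment> \<open>Rewriting generator sets as integrals of indicators of one coordinate lets
        the comparison of coordinate laws apply with \<open>g = indicator A\<close>.\<close>
      have ind: "emeasure \<rho> (theta n -` A \<inter> solenoid B r) = (\<integral>\<^sup>+x. indicator A (theta n x) \<partial>\<rho>)"
        if \<rho>: "sets \<rho> = sets (solenoid_algebra B r)" for \<rho>
      proof -
        have "theta n -` A \<inter> solenoid B r \<in> sets \<rho>"
          using measurable_sets[OF theta_measurable A, of n r] \<rho> by simp
        then have "emeasure \<rho> (theta n -` A \<inter> solenoid B r) =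
            (\<integral>\<^sup>+x. indicator (theta n -` A \<inter> solenoid B r) x \<partial>\<rho>)" by simp
        also have "\<dots> = (\<integral>\<^sup>+x. indicator A (theta n x) \<partial>\<rho>)"
          using sets_eq_imp_space_eq[OF \<rho>] by (intro nn_integral_cong) (simp add: indicator_def)
        finally show ?thesis .
      qed
      show "emeasure \<nu> (theta n -` A \<inter> solenoid B r) = emeasure \<mu> (theta n -` A \<inter> solenoid B r)"
        using \<nu> s\<mu> comp t0 A
        by (auto simp: ind intro!: nn_integral_theta_unique[OF r V])
    qed (use \<nu> s\<mu> in auto)
  qed (use s\<mu> finm comp t0 in auto)
qed

end
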